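(* For every integer $m\ge0$ the numbers $\mathop{\rm Li}\nolimits_{\langle2\rangle_m}(1/2)$ and $\mathop{\rm Li}\nolimits_{1,\langle2\rangle_m}(1/2)$ belong to the ring $\mathbb{Q}[\ln2,\zeta(2),\zeta(3),\dots]$. Moreover, for every $z\in\mathbb{C}$, $$G(z):=\sum_{m=0}^\infty(-1)^m\mathop{\rm Li}\nolimits_{\langle2\rangle_m}\!\left(\tfrac12\right)z^{2m}+\sum_{m=0}^\infty(-1)^{m+1}\mathop{\rm Li}\nolimits_{1,\langle2\rangle_m}\!\left(\tfrac12\right)z^{2m+1}=\frac{\Gamma(1/2)}{\Gamma(1+z/2)\,\Gamma(1/2-z/2)},$$ both series converging for all $z$.
   Context: For positive integers $s_1,\dots,s_l$, $\mathop{\rm Li}\nolimits_{s_1,\dots,s_l}(z)=\sum_{n_1>\dots>n_l\ge1}\frac{z^{n_1}}{n_1^{s_1}\cdots n_l^{s_l}}$ for $|z|<1$. $\langle2\rangle_m$ is the vector of $m$ twos; by convention $\mathop{\rm Li}\nolimits_{\langle2\rangle_0}=1$ (empty index) and $\mathop{\rm Li}\nolimits_{1,\langle2\rangle_0}=\mathop{\rm Li}\nolimits_1$. $\zeta$ is the Riemann zeta function and $\Gamma$ the Gamma function. *)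

theory Defs
  imports "HOL-Analysis.Analysis"
begin

definition Li_indices :: "nat \<Rightarrow> nat list set" where
  "Li_indices l = {ns. length ns = l \<and> sorted_wrt (>) ns \<and> (\<forall>n\<in>set ns. 1 \<le> n)}"

text \<open>
  Meant for \<open>norm z < 1\<close> and positive entries of \<open>s\<close>, where the family is absolutely summable,
  so that the unordered sum is the usual one. The empty index needs its own case because there
  is then no leading summation index to serve as the exponent of \<open>z\<close>.
\<close>
definition Li :: "nat list \<Rightarrow> complex \<Rightarrow> complex" where
  "Li s z =
     (if s = [] then 1
      else (\<Sum>\<^sub>\<infinity>ns\<in>Li_indices (length s).
              z ^ (ns ! 0) / (\<Prod>i<length s. of_nat (ns ! i) ^ (s ! i))))"

text \<open>The Dirichlet series, which is the Riemann zeta function for \<open>Re s > 1\<close> only.\<close>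
definition zeta :: "complex \<Rightarrow> complex" where
  "zeta s = (\<Sum>n. 1 / of_nat (Suc n) powr s)"

text \<open>
  The ring \<open>\<rat>[S]\<close> inside a field of characteristic 0. Closure under negation follows from
  \<open>-1 \<in> \<rat>\<close>.
\<close>
inductive_set rat_adjoin :: "'a::field_char_0 set \<Rightarrow> 'a set" for S :: "'a set" where
  rat: "x \<in> \<rat> \<Longrightarrow> x \<in> rat_adjoin S"
| gen: "x \<in> S \<Longrightarrow> x \<in> rat_adjoin S"
| add: "x \<in> rat_adjoin S \<Longrightarrow> y \<in> rat_adjoin S \<Longrightarrow> x + y \<in> rat_adjoin S"
| mult: "x \<in> rat_adjoin S \<Longrightarrow> y \<in> rat_adjoin S \<Longrightarrow> x * y \<in> rat_adjoin S"

definition ln2_zeta_ring :: "complex set" where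
  "ln2_zeta_ring = rat_adjoin (insert (of_real (ln 2)) {zeta (of_nat k) | k. k \<ge> 2})"

definition G_even_term :: "complex \<Rightarrow> nat \<Rightarrow> complex" where
  "G_even_term z m = (-1) ^ m * Li (replicate m 2) (1/2) * z ^ (2 * m)"

definition G_odd_term :: "complex \<Rightarrow> nat \<Rightarrow> complex" where
  "G_odd_term z m = (-1) ^ (m + 1) * Li (1 # replicate m 2) (1/2) * z ^ (2 * m + 1)"

definition G :: "complex \<Rightarrow> complex" where
  "G z = (\<Sum>m. G_even_term z m) + (\<Sum>m. G_odd_term z m)"

text \<open>
  A quotient \<open>a / (Gamma x * Gamma y)\<close> in HOL agrees with the entire function
  \<open>a * rGamma x * rGamma y\<close> also at the poles of \<open>Gamma\<close>, where both are 0.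
\<close>
lemma divide_Gamma_mult_eq_rGamma:
  "a / (Gamma x * Gamma y) = a * rGamma x * rGamma (y :: complex)"
  by (simp add: rGamma_inverse_Gamma divide_inverse)

end

(*
  With y = -z^2, the sums over decreasing index lists turn G z into
    1 + SUM_{n >= 1} 2^-n (-z^2/n^2 - z/n) PROD_{k < n} (1 - z^2/k^2) = 2F1(-z, 1 + z; 1; 1/2).
  For F c = 2F1(a, 1 - a; c; 1/2) there is a two-step contiguous relation
    c (c + 1) F c = (c + a) (c + 1 - a) F (c + 2),
  and F c tends to 1 as c grows, so F 1 is an infinite product of Gamma type.

  For the arithmetic statement, the logarithmic derivative of the Gamma quotient has derivatives
  at 0 that are polygamma values at 1 and 1/2, that is, rational multiples of ln 2 and zeta values.
  Leibniz' rule for G' = L G carries this over to the Taylor coefficients of G.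
*)
theory Submission
  imports Defs "HOL-Complex_Analysis.Complex_Analysis" "HOL-Real_Asymp.Real_Asymp"
begin

section \<open>Generating functions of the multiple polylogarithms\<close>

text \<open>These are the possible tails of an index list with head \<open>Suc j\<close>. The empty
  list is included and stands for an index list of length one.\<close>

definition decreasing_lists :: "nat \<Rightarrow> nat list set" where
  "decreasing_lists j = {ns. sorted_wrt (>) ns \<and> set ns \<subseteq> {1..j}}"

text \<open>The variable \<open>y\<close> marks the length, so that tails of all lengths can be
  summed at once.\<close>

definition inv_square_weight :: "'a \<Rightarrow> nat list \<Rightarrow> 'a :: field" where
  "inv_square_weight y ns = y ^ length ns / (\<Prod>i<length ns. of_nat (ns ! i) ^ 2)"

lemma inv_square_weight_Nil [simp]: "inv_square_weight y [] = 1"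
  by (simp add: inv_square_weight_def)

lemma inv_square_weight_Cons [simp]:
  "inv_square_weight y (n # ns) = y / of_nat n ^ 2 * inv_square_weight y ns"
  by (simp add: inv_square_weight_def prod.lessThan_Suc_shift del: prod.lessThan_Suc)

lemma norm_inv_square_weight:
  "norm (inv_square_weight y ns) =
   inv_square_weight (norm y) ns" for y :: "'a :: real_normed_field"
  by (simp add: inv_square_weight_def norm_divide norm_mult norm_power flip: prod_norm)

lemma decreasing_lists_0: "decreasing_lists 0 = {[]}"
  by (auto simp: decreasing_lists_def)

text \<open>Split by whether \<open>Suc j\<close> occurs; in a decreasing list it can only be the
  head.\<close>

lemma decreasing_lists_Suc:
  "decreasing_lists (Suc j) = decreasing_lists j \<union> Cons (Suc j) ` decreasing_lists j"
proof (intro equalityI subsetI)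
  fix ns assume ns: "ns \<in> decreasing_lists (Suc j)"
  show "ns \<in> decreasing_lists j \<union> Cons (Suc j) ` decreasing_lists j"
  proof (cases ns)
    case Nil
    thus ?thesis by (auto simp: decreasing_lists_def)
  next
    case (Cons n ms)
    show ?thesis
    proof (cases "n = Suc j")
      case True
      have "ms \<in> decreasing_lists j"
        using ns True Cons by (force simp: decreasing_lists_def)
      thus ?thesis using True Cons by auto
    next
      case False
      have "ns \<in> decreasing_lists j"
        using ns False Cons by (force simp: decreasing_lists_def)
      thus ?thesis by auto
    qed
  qed
qed (force simp: decreasing_lists_def)

lemma Suc_Cons_notin_decreasing_lists: "Suc j # ns \<notin> decreasing_lists j"
  by (auto simp: decreasing_lists_def)

lemma finite_decreasing_lists [simp]: "finite (decreasing_lists j)"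
  by (induction j) (auto simp: decreasing_lists_0 decreasing_lists_Suc)

text \<open>The type is left general because the real instance at \<open>norm y\<close> serves as a
  majorant of the complex one at \<open>y\<close>.\<close>

definition inv_square_prod :: "nat \<Rightarrow> 'a \<Rightarrow> 'a :: field" where
  "inv_square_prod j y = (\<Prod>k=1..j. 1 + y / of_nat k ^ 2)"

lemma inv_square_prod_0 [simp]: "inv_square_prod 0 y = 1"
  and inv_square_prod_Suc:
    "inv_square_prod (Suc j) y = inv_square_prod j y * (1 + y / of_nat (Suc j) ^ 2)"
  by (simp_all add: inv_square_prod_def)

text \<open>Expanding the product means choosing 1 or \<open>y / k^2\<close> from each factor, that
  is, a subset of \<open>{1..j}\<close>, which is the same as a decreasing list.\<close>

lemma sum_inv_square_weight:
  "(\<Sum>ns\<in>decreasing_lists j. inv_square_weight y ns) = inv_square_prod j y"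
proof (induction j)
  case 0
  show ?case by (simp add: decreasing_lists_0)
next
  case (Suc j)
  have "(\<Sum>ns\<in>decreasing_lists (Suc j). inv_square_weight y ns) =
        (\<Sum>ns\<in>decreasing_lists j. inv_square_weight y ns) +
        (\<Sum>ns\<in>Cons (Suc j) ` decreasing_lists j. inv_square_weight y ns)"
    unfolding decreasing_lists_Suc
    by (rule sum.union_disjoint) (auto simp: Suc_Cons_notin_decreasing_lists)
  also have "(\<Sum>ns\<in>Cons (Suc j) ` decreasing_lists j. inv_square_weight y ns) =
             y / of_nat (Suc j) ^ 2 * (\<Sum>ns\<in>decreasing_lists j. inv_square_weight y ns)"
    by (subst sum.reindex) (simp_all add: sum_distrib_left del: of_nat_Suc)
  finally show ?case
    by (simp add: Suc.IH inv_square_prod_Suc algebra_simps)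
qed

lemma inv_square_prod_nonneg: "0 \<le> (y :: real) \<Longrightarrow> 0 \<le> inv_square_prod j y"
  unfolding inv_square_prod_def by (intro prod_nonneg) auto

text \<open>Without the denominator, the ratio of consecutive terms is
  \<open>w * (1 + r / (j+1)^2)\<close>, which tends to \<open>w < 1\<close>. The denominator is at
  least 1 and only makes the terms smaller.\<close>

lemma summable_inv_square_prod:
  fixes w r :: real
  assumes "0 \<le> w" "w < 1" "0 \<le> r"
  shows "summable (\<lambda>j. w ^ Suc j / of_nat (Suc j) ^ p * inv_square_prod j r)"
proof -
  obtain c where c: "w < c" "c < 1" using assms dense by blast
  have "((\<lambda>j. w * (1 + r / real (Suc j) ^ 2)) \<longlongrightarrow> w) at_top"
    by real_asymp
  hence "\<forall>\<^sub>F j in at_top. w * (1 + r / real (Suc j) ^ 2) < c"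
    using c by (auto elim: order_tendstoD)
  then obtain N where N: "\<And>j. j \<ge> N \<Longrightarrow> w * (1 + r / real (Suc j) ^ 2) < c"
    by (auto simp: eventually_at_top_linorder)
  have "summable (\<lambda>j. w ^ Suc j * inv_square_prod j r)"
  proof (rule summable_ratio_test[OF \<open>c < 1\<close>])
    fix j assume "j \<ge> N"
    define A where "A = w ^ Suc j * inv_square_prod j r"
    have A: "A \<ge> 0" using assms inv_square_prod_nonneg[of r j] by (simp add: A_def)
    have eq: "w ^ Suc (Suc j) * inv_square_prod (Suc j) r = w * (1 + r / real (Suc j) ^ 2) * A"
      by (simp add: A_def inv_square_prod_Suc mult_ac)
    have "norm (w ^ Suc (Suc j) * inv_square_prod (Suc j) r) = w * (1 + r / real (Suc j) ^ 2) * A"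
      unfolding eq using A assms by simp
    also have "\<dots> \<le> c * A"
      using N[OF \<open>j \<ge> N\<close>] A by (intro mult_right_mono) auto
    finally show "norm (w ^ Suc (Suc j) * inv_square_prod (Suc j) r) \<le>
                  c * norm (w ^ Suc j * inv_square_prod j r)"
      using A by (simp add: A_def)
  qed
  thus ?thesis
  proof (rule summable_comparison_test'[where N = 0])
    fix j :: nat
    have "1 \<le> real (Suc j) ^ p" by simp
    moreover have "0 \<le> w ^ Suc j * inv_square_prod j r"
      using assms inv_square_prod_nonneg[of r j] by simp
    ultimately have "w ^ Suc j * inv_square_prod j r / real (Suc j) ^ p \<le>
                     w ^ Suc j * inv_square_prod j r / 1"
      by (intro divide_left_mono) auto
    thus "norm (w ^ Suc j / real (Suc j) ^ p * inv_square_prod j r) \<le>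
          w ^ Suc j * inv_square_prod j r"
      using assms inv_square_prod_nonneg[of r j] by (simp add: abs_mult)
  qed
qed

text \<open>
  Summing first over the tails of a decreasing index list with given head turns the elementary
  symmetric functions of \<open>1 / k\<^sup>2\<close> into a product.
\<close>
lemma Li_replicate_2_generating_function:
  fixes w y :: complex
  assumes w: "norm w < 1"
  shows "summable (\<lambda>j. w ^ Suc j / of_nat (Suc j) ^ p * inv_square_prod j y)"
    and "(\<lambda>m. Li (p # replicate m 2) w * y ^ m) sums
           (\<Sum>j. w ^ Suc j / of_nat (Suc j) ^ p * inv_square_prod j y)"
proof -
  define c where "c = (\<lambda>j. w ^ Suc j / of_nat (Suc j) ^ p)"
  \<comment> \<open>All depths form one family, indexed by the head \<open>Suc j\<close> and the
    tail \<open>ns\<close>.\<close>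
  define h where "h = (\<lambda>(j, ns). c j * inv_square_weight y ns)"
  have inner: "((\<lambda>ns. h (j, ns)) has_sum c j * inv_square_prod j y) (decreasing_lists j)" for j
    unfolding h_def by (rule has_sum_finiteI) (simp_all flip: sum_inv_square_weight add: sum_distrib_left)
  have inner_norm: "((\<lambda>ns. norm (h (j, ns))) has_sum norm (c j) * inv_square_prod j (norm y))
                      (decreasing_lists j)" for j
    unfolding h_def by (rule has_sum_finiteI)
      (simp_all flip: sum_inv_square_weight add: sum_distrib_left norm_mult norm_inv_square_weight)
  have norm_c: "norm (c j) = norm w ^ Suc j / of_nat (Suc j) ^ p" for j
    by (simp add: c_def norm_divide norm_mult norm_power del: of_nat_Suc)
  \<comment> \<open>Absolute summability of the double family permits regrouping it by length
    instead of by head.\<close>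
  have "summable (\<lambda>j. norm (c j) * inv_square_prod j (norm y))"
    unfolding norm_c using w by (intro summable_inv_square_prod) auto
  hence "(\<lambda>j. norm (c j) * inv_square_prod j (norm y)) summable_on UNIV"
    by (rule summable_nonneg_imp_summable_on) (simp add: inv_square_prod_nonneg)
  hence "(\<lambda>x. norm (h x)) summable_on Sigma UNIV decreasing_lists"
    by (intro summable_on_SigmaI[OF inner_norm]) auto
  hence summable: "h summable_on Sigma UNIV decreasing_lists"
    by (rule abs_summable_summable)
  then obtain S where S: "(h has_sum S) (Sigma UNIV decreasing_lists)"
    by (auto simp: summable_on_def)
  have "((\<lambda>j. c j * inv_square_prod j y) has_sum S) UNIV"
    by (rule has_sum_SigmaD[OF S inner])
  hence sums: "(\<lambda>j. c j * inv_square_prod j y) sums S"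
    by (rule has_sum_imp_sums)

  \<comment> \<open>The same family again, now indexed by the length of the tail and the whole index
    list, as in the definition of \<open>Li\<close>.\<close>
  define g where "g = (\<lambda>(m, ns). w ^ (ns ! 0) /
    (\<Prod>i<Suc m. of_nat (ns ! i) ^ ((p # replicate m 2) ! i)) * y ^ m)"
  have "(h has_sum S) (Sigma UNIV decreasing_lists) \<longleftrightarrow>
        (g has_sum S) (Sigma UNIV (\<lambda>m. Li_indices (Suc m)))"
  \<comment> \<open>Heads start at 1 while \<open>j\<close> starts at 0, hence \<open>Suc j\<close>
    in one direction and \<open>hd ns - 1\<close> in the other.\<close>
  proof (rule has_sum_reindex_bij_witness[where
        j = "\<lambda>(j, ns). (length ns, Suc j # ns)" and i = "\<lambda>(m, ns). (hd ns - 1, tl ns)"],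
        goal_cases)
    case (2 a)
    thus ?case by (force simp: Li_indices_def decreasing_lists_def)
  next
    case (3 b)
    obtain m n ns where "b = (m, n # ns)" "n \<ge> 1" "length ns = m"
      using 3 by (cases b; cases "snd b") (auto simp: Li_indices_def)
    thus ?case by auto
  next
    case (4 b)
    obtain m n ns where b: "b = (m, n # ns)" "n \<ge> 1" "length ns = m" "n # ns \<in> Li_indices (Suc m)"
      using 4 by (cases b; cases "snd b") (auto simp: Li_indices_def)
    thus ?case by (force simp: Li_indices_def decreasing_lists_def)
  next
    case (5 a)
    obtain j ns where a: "a = (j, ns)" by (cases a)
    have "(\<Prod>i<length ns. of_nat (ns ! i) ^ (replicate (length ns) 2 ! i)) =
          (\<Prod>i<length ns. of_nat (ns ! i) ^ 2 :: complex)"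
      by (intro prod.cong) auto
    thus ?case
      by (simp add: a g_def h_def c_def inv_square_weight_def prod.lessThan_Suc_shift
            del: prod.lessThan_Suc of_nat_Suc)
  qed auto
  hence S': "(g has_sum S) (Sigma UNIV (\<lambda>m. Li_indices (Suc m)))"
    using S by simp
  have "((\<lambda>ns. g (m, ns)) has_sum Li (p # replicate m 2) w * y ^ m) (Li_indices (Suc m))" for m
  proof -
    have "(\<lambda>ns. g (m, ns)) summable_on Li_indices (Suc m)"
      using S' by (intro summable_on_SigmaD1[where f = "\<lambda>m ns. g (m, ns)" and A = UNIV])
        (auto simp: summable_on_def)
    moreover have "infsum (\<lambda>ns. g (m, ns)) (Li_indices (Suc m)) = Li (p # replicate m 2) w * y ^ m"
      by (simp add: g_def Li_def infsum_cmult_left' del: prod.lessThan_Suc times_divide_eq_left)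
    ultimately show ?thesis
      by (metis has_sum_infsum)
  qed
  from has_sum_SigmaD[OF S' this]
  have "(\<lambda>m. Li (p # replicate m 2) w * y ^ m) sums S"
    by (rule has_sum_imp_sums)
  with sums show "summable (\<lambda>j. w ^ Suc j / of_nat (Suc j) ^ p * inv_square_prod j y)"
    and "(\<lambda>m. Li (p # replicate m 2) w * y ^ m) sums
           (\<Sum>j. w ^ Suc j / of_nat (Suc j) ^ p * inv_square_prod j y)"
    by (auto simp: c_def sums_iff)
qed

section \<open>Bailey's summation\<close>

text \<open>The terms of the hypergeometric series \<open>\<^sub>2F\<^sub>1(a, 1 - a; c; 1/2)\<close>.\<close>
definition bailey_term :: "complex \<Rightarrow> complex \<Rightarrow> nat \<Rightarrow> complex" where
  "bailey_term a c n =
     pochhammer a n * pochhammer (1 - a) n / (pochhammer c n * fact n * 2 ^ n)"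

lemma bailey_term_0 [simp]: "bailey_term a c 0 = 1"
  by (simp add: bailey_term_def)

lemma bailey_term_Suc:
  "bailey_term a c (Suc n) =
     bailey_term a c n * ((a + of_nat n) * (1 - a + of_nat n) / (2 * (c + of_nat n) * of_nat (Suc n)))"
  by (simp add: bailey_term_def pochhammer_Suc mult_ac)

lemma of_nat_Suc_add_of_nat_neq_0: "of_nat (Suc k) + of_nat n \<noteq> (0 :: complex)"
  by (metis of_nat_add add_Suc of_nat_neq_0)

text \<open>The ratio of consecutive terms tends to 1/2, the argument of the series. Its norm is at
  most \<open>q n\<close>, which has the same limit, and 3/4 is just a number between 1/2 and
  1.\<close>

lemma summable_bailey_term: "summable (\<lambda>n. norm (bailey_term a (of_nat (Suc k)) n))"
proof -
  define q where "q = (\<lambda>n. (norm a + real n) * (1 + norm a + real n) /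
                          (2 * (real k + 1 + real n) * (real n + 1)))"
  have "q \<longlonglongrightarrow> 1 / 2"
    unfolding q_def by real_asymp
  hence "\<forall>\<^sub>F n in at_top. q n < 3 / 4"
    by (rule order_tendstoD) simp
  then obtain N where N: "\<And>n. n \<ge> N \<Longrightarrow> q n < 3 / 4"
    by (auto simp: eventually_at_top_linorder)
  show ?thesis
  proof (rule summable_ratio_test[of "3 / 4" N])
    fix n assume "n \<ge> N"
    have "norm (1 - a + of_nat n) \<le> norm (1 + of_nat n :: complex) + norm a"
      using norm_triangle_ineq4[of "1 + of_nat n :: complex" a] by (simp add: algebra_simps)
    also have "norm (1 + of_nat n :: complex) = 1 + real n"
      by (metis norm_of_nat of_nat_Suc)
    finally have A: "norm (1 - a + of_nat n) \<le> 1 + norm a + real n" by simp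
    have B: "norm (a + of_nat n) \<le> norm a + real n"
      using norm_triangle_ineq[of a "of_nat n"] by simp
    have C: "norm (of_nat (Suc k) + of_nat n :: complex) = real k + 1 + real n"
      by (metis norm_of_nat of_nat_add of_nat_Suc add.commute)
    have "norm ((a + of_nat n) * (1 - a + of_nat n) /
            (2 * (of_nat (Suc k) + of_nat n) * of_nat (Suc n))) =
          norm (a + of_nat n) * norm (1 - a + of_nat n) /
            (2 * (real k + 1 + real n) * (real n + 1))"
      unfolding norm_divide norm_mult C norm_of_nat by simp
    also have "\<dots> \<le> q n"
      unfolding q_def using A B by (intro divide_right_mono mult_mono) auto
    also have "\<dots> \<le> 3 / 4"
      using N[OF \<open>n \<ge> N\<close>] by simp
    finally have "norm (bailey_term a (of_nat (Suc k)) (Suc n)) \<le>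
        norm (bailey_term a (of_nat (Suc k)) n) * (3 / 4)"
      unfolding bailey_term_Suc norm_mult[of "bailey_term _ _ _"]
      by (intro mult_left_mono) simp_all
    thus "norm (norm (bailey_term a (of_nat (Suc k)) (Suc n))) \<le>
          3 / 4 * norm (norm (bailey_term a (of_nat (Suc k)) n))"
      by simp
  qed simp
qed

definition bailey_sum :: "complex \<Rightarrow> complex \<Rightarrow> complex" where
  "bailey_sum a c = (\<Sum>n. bailey_term a c n)"

text \<open>Both sides are \<open>pochhammer c (n + 2)\<close>, with either the first two or the
  last two factors split off.\<close>

lemma pochhammer_plus_2:
  fixes c :: "'a :: field"
  shows "pochhammer (c + 2) n * (c * (c + 1)) = pochhammer c n * ((c + of_nat n) * (c + of_nat n + 1))"
proof -
  have "pochhammer c (Suc (Suc n)) = c * ((c + 1) * pochhammer (c + 2) n)"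
    unfolding pochhammer_rec by (simp add: add.assoc)
  moreover have "pochhammer c (Suc (Suc n)) = pochhammer c n * ((c + of_nat n) * (c + of_nat n + 1))"
    by (simp add: pochhammer_Suc mult_ac add_ac)
  ultimately show ?thesis by (simp add: mult_ac)
qed

text \<open>The telescoping certificate \<open>U\<close> comes from Zeilberger's algorithm with shift 2 in \<open>c\<close>.\<close>
lemma bailey_sum_contiguous:
  assumes c: "c = of_nat (Suc k)"
  shows "c * (c + 1) * bailey_sum a c = (c + a) * (c + 1 - a) * bailey_sum a (c + 2)"
proof -
  define U where "U = (\<lambda>n. - 2 * of_nat n * bailey_term a c n * (c * (c + 1)) / (c + of_nat n))"
  have c2: "c + 2 = of_nat (Suc (k + 2))" by (simp add: c)
  have nz: "c + of_nat n \<noteq> 0" "c + of_nat n + 1 \<noteq> 0" for n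
    using of_nat_Suc_add_of_nat_neq_0[of k n] of_nat_Suc_add_of_nat_neq_0[of k "Suc n"]
    by (simp_all add: c add_ac)
  have nz': "c \<noteq> 0" "c + 1 \<noteq> 0" using nz[of 0] by simp_all
  have step: "c * (c + 1) * bailey_term a c n - (c + a) * (c + 1 - a) * bailey_term a (c + 2) n =
              U (Suc n) - U n" for n
  proof -
    define x where "x = (of_nat n :: complex)"
    define t where "t = bailey_term a c n"
    have x: "c + x \<noteq> 0" "c + x + 1 \<noteq> 0" "x + 1 \<noteq> 0"
      using nz[of n] of_nat_neq_0[of n, where 'a = complex] by (simp_all add: x_def add_ac)
    have "pochhammer (c + 2) n = pochhammer c n * ((c + x) * (c + x + 1)) / (c * (c + 1))"
      using pochhammer_plus_2[of c n] nz' by (simp add: x_def nonzero_eq_divide_eq)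
    hence t2: "bailey_term a (c + 2) n = t * (c * (c + 1)) / ((c + x) * (c + x + 1))"
      by (simp add: bailey_term_def t_def)
    have "U (Suc n) - U n = 2 * (c * (c + 1)) * t *
            (x / (c + x) - (x + 1) * ((a + x) * (1 - a + x) / (2 * (c + x) * (x + 1))) / (c + x + 1))"
      by (simp add: U_def bailey_term_Suc x_def[symmetric] t_def[symmetric] algebra_simps
            diff_divide_distrib add_divide_distrib)
    \<comment> \<open>With the common factor \<open>t\<close> pulled out, only an identity of
      rational functions remains.\<close>
    also have "x / (c + x) - (x + 1) * ((a + x) * (1 - a + x) / (2 * (c + x) * (x + 1))) / (c + x + 1)
               = (1 - (c + a) * (c + 1 - a) / ((c + x) * (c + x + 1))) / 2"
      using x by (simp add: divide_simps) algebra
    also have "2 * (c * (c + 1)) * t * \<dots> =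
               c * (c + 1) * t - (c + a) * (c + 1 - a) * bailey_term a (c + 2) n"
    proof -
      have "2 * C * t * ((1 - E / P) / 2) = C * t - E * (t * C / P)" for C E P :: complex
      proof -
        have "2 * C * t * ((1 - E / P) / 2) = C * t * (1 - E / P)" by simp
        thus ?thesis by (simp add: right_diff_distrib mult_ac)
      qed
      thus ?thesis by (simp only: t2)
    qed
    finally show ?thesis by (simp add: t_def)
  qed
  have sm: "summable (bailey_term a c)" "summable (bailey_term a (c + 2))"
    using summable_bailey_term[of a k] summable_bailey_term[of a "k + 2"]
    unfolding c2 by (auto simp only: c intro: summable_norm_cancel)
  \<comment> \<open>Since \<open>n / (c + n)\<close> has norm at most 1, \<open>U\<close> is
    dominated by a constant times the terms of a convergent series.\<close>
  have "U \<longlonglongrightarrow> 0"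
  proof (rule Lim_null_comparison)
    show "\<forall>\<^sub>F n in sequentially. norm (U n) \<le> 2 * norm (c * (c + 1)) * norm (bailey_term a c n)"
    proof (intro always_eventually allI)
      fix n
      have "norm (c + of_nat n) = real (Suc k) + real n"
        unfolding c by (metis norm_of_nat of_nat_add)
      hence "norm (of_nat n / (c + of_nat n)) \<le> 1"
        by (simp add: norm_divide)
      hence "norm (of_nat n / (c + of_nat n)) * (2 * norm (c * (c + 1)) * norm (bailey_term a c n))
             \<le> 1 * (2 * norm (c * (c + 1)) * norm (bailey_term a c n))"
        by (intro mult_right_mono) auto
      thus "norm (U n) \<le> 2 * norm (c * (c + 1)) * norm (bailey_term a c n)"
        by (simp add: U_def norm_mult norm_divide mult_ac)
    qed
    show "(\<lambda>n. 2 * norm (c * (c + 1)) * norm (bailey_term a c n)) \<longlonglongrightarrow> 0"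
      using summable_LIMSEQ_zero[OF sm(1)] by (intro tendsto_mult_right_zero tendsto_norm_zero)
  qed
  \<comment> \<open>The factor \<open>of_nat n\<close> makes \<open>U 0\<close> vanish, so there is
    no boundary term and the relation is homogeneous.\<close>
  hence "(\<lambda>n. U (Suc n) - U n) sums (0 - U 0)"
    by (rule telescope_sums)
  moreover have "(\<lambda>n. U (Suc n) - U n) sums
      (c * (c + 1) * bailey_sum a c - (c + a) * (c + 1 - a) * bailey_sum a (c + 2))"
    unfolding step[symmetric] bailey_sum_def using sm by (intro sums_diff sums_mult summable_sums)
  ultimately show ?thesis
    by (auto simp: U_def dest: sums_unique2)
qed

text \<open>Keep the first factor \<open>k + 1\<close> and bound each later factor
  \<open>k + i\<close> below by \<open>i\<close>. The retained factor supplies the decay in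
  \<open>k\<close>; for \<open>n = 0\<close> there is no such factor.\<close>

lemma fact_le_pochhammer_of_nat_Suc:
  "real (Suc k) * fact n \<le> pochhammer (real (Suc k)) n" if "n > 0"
  using that
proof (induction n rule: nat_induct_non_zero)
  case (Suc n)
  have "real (Suc k) * fact (Suc n) = real (Suc k) * fact n * real (Suc n)" by simp
  also have "\<dots> \<le> pochhammer (real (Suc k)) n * (real (Suc k) + real n)"
    using Suc by (intro mult_mono) (auto intro!: pochhammer_nonneg)
  finally show ?case by (simp add: pochhammer_Suc)
qed simp

text \<open>Each term after the zeroth has norm at most \<open>1 / c\<close> times that of the term
  for \<open>c = 1\<close>, so the sum differs from its leading 1 by at most \<open>M / c\<close>.
  Odd \<open>c\<close> are the ones reached from 1 in steps of 2.\<close>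

lemma bailey_sum_tendsto_1: "(\<lambda>k. bailey_sum a (of_nat (Suc (2 * k)))) \<longlonglongrightarrow> 1"
proof -
  define M where "M = (\<Sum>n. norm (bailey_term a 1 n))"
  have sm1: "summable (\<lambda>n. norm (bailey_term a 1 n))"
    using summable_bailey_term[of a 0] by simp
  have bound: "norm (bailey_sum a (of_nat (Suc k)) - 1) \<le> M / real (Suc k)" for k
  proof -
    define c where "c = (of_nat (Suc k) :: complex)"
    have sm: "summable (\<lambda>n. norm (bailey_term a c n))"
      unfolding c_def by (rule summable_bailey_term)
    have *: "norm (bailey_term a c (Suc n)) \<le> norm (bailey_term a 1 (Suc n)) / real (Suc k)" for n
    proof -
      define A where "A = norm (pochhammer a (Suc n) * pochhammer (1 - a) (Suc n))"
      have "pochhammer c (Suc n) = complex_of_real (pochhammer (real (Suc k)) (Suc n))"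
        unfolding c_def by (metis pochhammer_of_real of_real_of_nat_eq)
      hence p: "norm (pochhammer c (Suc n)) = pochhammer (real (Suc k)) (Suc n)"
        by (simp add: pochhammer_nonneg)
      have "norm (bailey_term a c (Suc n)) =
            A / (pochhammer (real (Suc k)) (Suc n) * (fact (Suc n) * 2 ^ Suc n))"
        unfolding bailey_term_def norm_divide norm_mult p A_def
        by (simp add: norm_mult norm_power del: fact_Suc pochhammer_Suc)
      also have "\<dots> \<le> A / (real (Suc k) * fact (Suc n) * (fact (Suc n) * 2 ^ Suc n))"
        using fact_le_pochhammer_of_nat_Suc[of "Suc n" k]
        by (intro divide_left_mono mult_right_mono mult_pos_pos pochhammer_pos)
           (auto simp: A_def simp del: fact_Suc)
      also have "\<dots> = norm (bailey_term a 1 (Suc n)) / real (Suc k)"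
        by (simp add: bailey_term_def norm_divide norm_mult norm_power A_def
              flip: pochhammer_fact del: fact_Suc)
      finally show ?thesis .
    qed
    have sm': "summable (\<lambda>n. norm (bailey_term a c (Suc n)))"
              "summable (\<lambda>n. norm (bailey_term a 1 (Suc n)))"
      using sm sm1 by (simp_all add: summable_Suc_iff[where f = "\<lambda>n. norm (bailey_term a _ n)"])
    have "bailey_sum a c - 1 = (\<Sum>n. bailey_term a c (Suc n))"
      unfolding bailey_sum_def using suminf_split_head[OF summable_norm_cancel[OF sm]] by simp
    also have "norm \<dots> \<le> (\<Sum>n. norm (bailey_term a c (Suc n)))"
      by (rule summable_norm[OF sm'(1)])
    also have "\<dots> \<le> (\<Sum>n. norm (bailey_term a 1 (Suc n)) / real (Suc k))"
      by (rule suminf_le[OF * sm'(1) summable_divide[OF sm'(2)]])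
    also have "\<dots> = (\<Sum>n. norm (bailey_term a 1 (Suc n))) / real (Suc k)"
      by (rule suminf_divide[OF sm'(2)])
    also have "(\<Sum>n. norm (bailey_term a 1 (Suc n))) \<le> M"
      using suminf_split_head[OF sm1] by (simp add: M_def)
    finally show ?thesis
      by (simp add: c_def divide_right_mono)
  qed
  have "\<forall>\<^sub>F k in sequentially. norm (bailey_sum a (of_nat (Suc (2 * k))) - 1) \<le> M / real (Suc (2 * k))"
    by (intro always_eventually allI bound)
  moreover have "(\<lambda>k. M / real (Suc (2 * k))) \<longlonglongrightarrow> 0"
    by real_asymp
  ultimately show ?thesis
    by (rule LIM_zero_cancel[OF Lim_null_comparison])
qed

text \<open>Iterating the contiguous relation from \<open>c = 1\<close> produces the finite products
  \<open>Q k\<close>, whose limit is read off from Gauss' product for the reciprocal Gamma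
  function.\<close>

theorem bailey_sum_1: "bailey_sum a 1 = Gamma (1/2) * rGamma (1/2 + a/2) * rGamma (1 - a/2)"
proof -
  \<comment> \<open>These are half of \<open>c + a\<close> and of \<open>c + 1 - a\<close> at
    \<open>c = 1\<close>; increasing \<open>c\<close> by 2 increases both by 1.\<close>
  define x y where "x = 1/2 + a/2" and "y = 1 - a/2"
  define Q where "Q = (\<lambda>k. pochhammer x k * pochhammer y k / (pochhammer (1/2) k * pochhammer 1 k))"
  have half: "1/2 \<notin> (\<int>\<^sub>\<le>\<^sub>0 :: complex set)"
    by (auto elim!: nonpos_Ints_cases dest!: arg_cong[where f = Re])
  have Q: "bailey_sum a 1 = Q k * bailey_sum a (of_nat (Suc (2 * k)))" for k
  proof (induction k)
    case (Suc k)
    define c :: complex where "c = of_nat (Suc (2 * k))"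
    have c: "c \<noteq> 0" "c + 1 \<noteq> 0"
      using of_nat_Suc_add_of_nat_neq_0[of "2 * k" 0] of_nat_Suc_add_of_nat_neq_0[of "2 * k" 1]
      by (simp_all add: c_def)
    have "bailey_sum a 1 = Q k * bailey_sum a c"
      by (simp only: Suc.IH c_def)
    also have "bailey_sum a c = (c + a) * (c + 1 - a) / (c * (c + 1)) * bailey_sum a (c + 2)"
      using bailey_sum_contiguous[OF c_def, of a] c by (simp add: nonzero_eq_divide_eq mult_ac)
    also have "c + 2 = of_nat (Suc (2 * Suc k))"
      by (simp add: c_def)
    also have "(c + a) * (c + 1 - a) / (c * (c + 1)) =
               (x + of_nat k) * (y + of_nat k) / ((1/2 + of_nat k) * (1 + of_nat k))"
    proof -
      have e: "c + a = 2 * (x + of_nat k)" "c + 1 - a = 2 * (y + of_nat k)"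
              "c = 2 * (1/2 + of_nat k)" "c + 1 = 2 * (1 + of_nat k)"
        by (simp_all add: c_def x_def y_def field_simps)
      have "(2 * X) * (2 * Y) / ((2 * P) * (2 * R)) = X * Y / (P * R)" for X Y P R :: complex
        by simp
      from this[of "x + of_nat k" "y + of_nat k" "1/2 + of_nat k" "1 + of_nat k"] show ?thesis
        by (simp only: e[symmetric])
    qed
    finally show ?case
      by (simp add: Q_def pochhammer_Suc mult_ac)
  qed (simp add: Q_def)
  have "(\<lambda>n. rGamma_series x n * rGamma_series y n / (rGamma_series (1/2) n * rGamma_series 1 n))
          \<longlonglongrightarrow> rGamma x * rGamma y / (rGamma (1/2) * rGamma 1)"
    using half by (intro tendsto_divide tendsto_mult rGamma_series_LIMSEQ) (simp add: rGamma_eq_zero_iff)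
  \<comment> \<open>The index is shifted because \<open>rGamma_series u n\<close> contains
    \<open>pochhammer u (Suc n)\<close>.\<close>
  also have "(\<lambda>n. rGamma_series x n * rGamma_series y n / (rGamma_series (1/2) n * rGamma_series 1 n)) =
             (\<lambda>n. Q (Suc n))"
  proof
    fix n
    define e where "e = (\<lambda>u :: complex. exp (u * of_real (ln (of_nat n))))"
    have series: "rGamma_series u n = pochhammer u (Suc n) / (fact n * e u)" for u
      by (simp add: rGamma_series_def e_def)
    \<comment> \<open>The powers of \<open>n\<close> cancel because
      \<open>x + y = 1/2 + 1\<close>.\<close>
    have e_mult: "e x * e y = e (1/2) * e 1"
      by (simp add: e_def x_def y_def field_simps flip: exp_add)
    have e_nz: "e u \<noteq> 0" for u by (simp add: e_def)
    have "X / (f * ex) * (Y / (f * ey)) / (H / (f * eh) * (K / (f * eo))) = X * Y / (H * K)"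
      if "ex * ey = eh * eo" "ex \<noteq> 0" "ey \<noteq> 0" "eh \<noteq> 0" "eo \<noteq> 0" "f \<noteq> 0" for X Y H K f ex ey eh eo :: complex
    proof -
      have "X / (f * ex) * (Y / (f * ey)) / (H / (f * eh) * (K / (f * eo))) =
            (X * Y / (H * K)) * (f * f * (eh * eo) / (f * f * (ex * ey)))"
        by simp
      also have "f * f * (eh * eo) / (f * f * (ex * ey)) = 1"
        using that by (simp del: mult_cancel_left)
      finally show ?thesis by simp
    qed
    from this[OF e_mult e_nz e_nz e_nz e_nz fact_nonzero] show "rGamma_series x n * rGamma_series y n /
        (rGamma_series (1/2) n * rGamma_series 1 n) = Q (Suc n)"
      unfolding series Q_def .
  qed
  finally have "(\<lambda>n. Q (Suc n)) \<longlonglongrightarrow> rGamma x * rGamma y / (rGamma (1/2) * rGamma 1)" .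
  hence "(\<lambda>k. Q (Suc k) * bailey_sum a (of_nat (Suc (2 * Suc k)))) \<longlonglongrightarrow>
      rGamma x * rGamma y / (rGamma (1/2) * rGamma 1) * 1"
    by (rule tendsto_mult) (rule LIMSEQ_Suc[OF bailey_sum_tendsto_1])
  \<comment> \<open>By \<open>Q\<close> the sequence is constantly \<open>bailey_sum a 1\<close>, so
    its limit is that value.\<close>
  hence "bailey_sum a 1 = rGamma x * rGamma y / rGamma (1/2)"
    unfolding Q[symmetric] by (simp add: LIMSEQ_const_iff)
  also have "\<dots> = Gamma (1/2) * rGamma x * rGamma y"
  proof -
    have "X * Y / inverse c = c * X * Y" for X Y c :: complex
      by (simp add: divide_inverse)
    thus ?thesis by (simp only: rGamma_inverse_Gamma[of "1/2"])
  qed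
  finally show ?thesis
    by (simp only: x_def y_def)
qed

section \<open>Taylor coefficients of the Gamma quotient\<close>

lemma rat_adjoin_uminus: "x \<in> rat_adjoin S \<Longrightarrow> - x \<in> rat_adjoin S"
  using rat_adjoin.mult[OF rat_adjoin.rat[of "-1"], of x S] by simp

lemma rat_adjoin_rat_mult: "c \<in> \<rat> \<Longrightarrow> x \<in> rat_adjoin S \<Longrightarrow> c * x \<in> rat_adjoin S"
  by (intro rat_adjoin.mult rat_adjoin.rat[of c])

lemma rat_adjoin_sum: "(\<And>i. i \<in> A \<Longrightarrow> f i \<in> rat_adjoin S) \<Longrightarrow> sum f A \<in> rat_adjoin S"
  by (induction A rule: infinite_finite_induct) (auto intro: rat_adjoin.intros)

section \<open>Zeta values and polygamma values at 1 and 1/2\<close>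

lemma zeta_sums:
  assumes "n \<ge> 2"
  shows "(\<lambda>k. inverse (of_nat (Suc k) ^ n)) sums zeta (of_nat n)"
proof -
  have "summable (\<lambda>k. inverse ((1 + of_nat k :: complex) ^ n))"
    using assms by (intro Polygamma_converges') auto
  hence "(\<lambda>k. inverse (of_nat (Suc k) ^ n)) sums (\<Sum>k. inverse (of_nat (Suc k) ^ n :: complex))"
    by (simp add: sums_iff)
  also have "(\<Sum>k. inverse (of_nat (Suc k) ^ n :: complex)) = zeta (of_nat n)"
    unfolding zeta_def by (intro suminf_cong) (simp add: powr_nat' inverse_eq_divide del: of_nat_Suc)
  finally show ?thesis .
qed

text \<open>At 1 the polygamma series runs over \<open>1 / (k + 1)^(n + 1)\<close>, so it is the
  zeta series up to sign and factorial.\<close>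

lemma Polygamma_1_eq_zeta:
  assumes "n > 0"
  shows "Polygamma n 1 = (-1) ^ Suc n * fact n * zeta (of_nat (Suc n))"
proof -
  have "(-1) ^ Suc n * Polygamma n 1 / fact n = zeta (of_nat (Suc n))"
    using Polygamma_LIMSEQ[of "1 :: complex" n] zeta_sums[of "Suc n"] assms
    by (intro sums_unique2[of "\<lambda>k. inverse (of_nat (Suc k) ^ Suc n)"]) (simp_all add: add_ac)
  hence "(-1) ^ Suc n * ((-1) ^ Suc n * Polygamma n 1) = (-1) ^ Suc n * fact n * zeta (of_nat (Suc n))"
    by (simp add: field_simps)
  thus ?thesis
    by (simp flip: mult.assoc power_add power_mult_distrib)
qed

text \<open>Splitting \<open>\<zeta>(s)\<close> into even and odd denominators.\<close>
lemma Polygamma_one_half: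
  assumes "n > 0"
  shows "Polygamma n (1/2 :: complex) = (2 ^ Suc n - 1) * Polygamma n 1"
proof -
  define s where "s = Suc n"
  define A where "A = (-1) ^ s * Polygamma n (1 :: complex) / fact n"
  define B where "B = (-1) ^ s * Polygamma n (1/2 :: complex) / fact n"
  have A: "(\<lambda>k. inverse (of_nat (Suc k) ^ s)) sums A"
    using Polygamma_LIMSEQ[of "1 :: complex" n] assms by (simp add: A_def s_def add_ac)
  have B: "(\<lambda>k. inverse ((1/2 + of_nat k) ^ s)) sums B"
    using Polygamma_LIMSEQ[of "1/2 :: complex" n] assms by (simp add: B_def s_def add_ac)
  \<comment> \<open>Pair consecutive denominators: \<open>2 * n + 1\<close> is twice
    \<open>1/2 + n\<close> and contributes to \<open>B\<close>, \<open>2 * n + 2\<close> is twice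
    \<open>n + 1\<close> and contributes to \<open>A\<close>.\<close>
  have "(\<lambda>n. \<Sum>k = n * 2..<n * 2 + 2. inverse (of_nat (Suc k) ^ s)) sums A"
    by (rule sums_group[OF A]) simp
  also have "(\<lambda>n. \<Sum>k = n * 2..<n * 2 + 2. inverse (of_nat (Suc k) ^ s)) =
             (\<lambda>n. inverse (2 ^ s) * (inverse ((1/2 + of_nat n) ^ s) + inverse (of_nat (Suc n) ^ s)) :: complex)"
  proof
    fix n
    have "(of_nat (Suc (n * 2)) :: complex) = 2 * (1/2 + of_nat n)"
         "(of_nat (Suc (Suc (n * 2))) :: complex) = 2 * of_nat (Suc n)"
      by (simp_all add: field_simps)
    moreover have "(\<Sum>k = n * 2..<n * 2 + 2. inverse (of_nat (Suc k) ^ s :: complex)) =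
        inverse (of_nat (Suc (n * 2)) ^ s) + inverse (of_nat (Suc (Suc (n * 2))) ^ s)"
      by (simp add: numeral_2_eq_2)
    ultimately show "(\<Sum>k = n * 2..<n * 2 + 2. inverse (of_nat (Suc k) ^ s)) =
          inverse (2 ^ s) * (inverse ((1/2 + of_nat n) ^ s) + inverse (of_nat (Suc n) ^ s) :: complex)"
      by (simp only: power_mult_distrib inverse_mult_distrib distrib_left[of "inverse _"])
  qed
  finally have "A = inverse (2 ^ s) * (B + A)"
    using sums_mult[OF sums_add[OF B A], of "inverse (2 ^ s)"] by (rule sums_unique2)
  hence "B = (2 ^ s - 1) * A"
    by (simp add: field_simps)
  hence "(-1) ^ s / fact n * Polygamma n (1/2 :: complex) = (-1) ^ s / fact n * ((2 ^ s - 1) * Polygamma n 1)"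
    by (simp add: A_def B_def mult_ac)
  thus ?thesis
    unfolding s_def by (subst (asm) mult_cancel_left) simp
qed

lemma ln2_in_ring: "of_real (ln 2) \<in> ln2_zeta_ring"
  unfolding ln2_zeta_ring_def by (rule rat_adjoin.gen) simp

lemma Polygamma_1_in_ring:
  assumes "n > 0"
  shows "Polygamma n 1 \<in> ln2_zeta_ring"
proof -
  have "zeta (of_nat (Suc n)) \<in> ln2_zeta_ring"
    unfolding ln2_zeta_ring_def using assms
    by (intro rat_adjoin.gen insertI2 CollectI exI[of _ "Suc n"]) auto
  moreover have "(-1) ^ Suc n * fact n \<in> (\<rat> :: complex set)"
    by (metis Rats_minus_iff Rats_1 Rats_mult Rats_power Rats_of_nat of_nat_fact)
  ultimately show ?thesis
    unfolding Polygamma_1_eq_zeta[OF assms] ln2_zeta_ring_def by (rule rat_adjoin_rat_mult[rotated])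
qed

section \<open>Derivatives at 0 of the Gamma quotient and of its logarithmic derivative\<close>

text \<open>The form with \<open>rGamma\<close> is entire, so no poles have to be excluded.\<close>

definition gamma_quotient :: "complex \<Rightarrow> complex" where
  "gamma_quotient z = Gamma (1/2) * rGamma (1 + z/2) * rGamma (1/2 - z/2)"

definition gamma_quotient_logderiv :: "complex \<Rightarrow> complex" where
  "gamma_quotient_logderiv z = (Digamma (1/2 - z/2) - Digamma (1 + z/2)) / 2"

lemma Re_pos_imp_notin_nonpos_Ints: "Re z > 0 \<Longrightarrow> z \<notin> \<int>\<^sub>\<le>\<^sub>0"
  by (auto elim!: nonpos_Ints_cases)

text \<open>Both arguments have positive real part on the unit disc. The radius cannot be enlarged,
  as \<open>1/2 - z/2\<close> vanishes at \<open>z = 1\<close>.\<close>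

lemma nonpos_Ints_outside:
  fixes z :: complex
  assumes "z \<in> ball 0 1"
  shows "1 + z/2 \<notin> \<int>\<^sub>\<le>\<^sub>0" "1/2 - z/2 \<notin> \<int>\<^sub>\<le>\<^sub>0"
proof -
  have "\<bar>Re z\<bar> < 1"
    using assms abs_Re_le_cmod[of z] by simp
  hence "Re (1 + z/2) > 0" "Re (1/2 - z/2) > 0" by auto
  thus "1 + z/2 \<notin> \<int>\<^sub>\<le>\<^sub>0" "1/2 - z/2 \<notin> \<int>\<^sub>\<le>\<^sub>0"
    by (simp_all only: Re_pos_imp_notin_nonpos_Ints not_False_eq_True)
qed

lemma gamma_quotient_0: "gamma_quotient 0 = 1"
proof -
  have "(1/2 :: complex) \<notin> \<int>\<^sub>\<le>\<^sub>0" using nonpos_Ints_outside(2)[of 0] by simp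
  thus ?thesis by (simp add: gamma_quotient_def rGamma_inverse_Gamma Gamma_eq_zero_iff)
qed

text \<open>Away from the poles, \<open>rGamma\<close> has logarithmic derivative
  \<open>- Digamma\<close>; the inner slopes are 1/2 and -1/2.\<close>

lemma deriv_gamma_quotient:
  assumes "z \<in> ball 0 1"
  shows "deriv gamma_quotient z = gamma_quotient_logderiv z * gamma_quotient z"
proof -
  note * = nonpos_Ints_outside[OF assms]
  have "(gamma_quotient has_field_derivative gamma_quotient_logderiv z * gamma_quotient z) (at z)"
    unfolding gamma_quotient_def [abs_def] gamma_quotient_logderiv_def
    by (rule has_field_derivative_rGamma_no_nonpos_int[THEN DERIV_chain2] derivative_eq_intros refl * | simp)+
       (simp add: field_simps)
  thus ?thesis by (rule DERIV_imp_deriv)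
qed

lemma higher_deriv_gamma_quotient_logderiv:
  "(deriv ^^ n) gamma_quotient_logderiv 0 =
     ((- 1/2) ^ n * Polygamma n (1/2) - (1/2) ^ n * Polygamma n 1) / 2"
proof -
  define T where "T = - (\<int>\<^sub>\<le>\<^sub>0 :: complex set)"
  define B where "B = ball (0 :: complex) 1"
  have T: "open T" "Polygamma 0 holomorphic_on T"
    by (auto simp: T_def intro: holomorphic_on_Polygamma)
  have B: "open B" "0 \<in> B" by (auto simp: B_def)
  have inT: "(1/2) * w + 1 \<in> T" "(-1/2) * w + 1/2 \<in> T" if "w \<in> B" for w
    using nonpos_Ints_outside[of w] that by (auto simp: T_def B_def algebra_simps)
  \<comment> \<open>The arguments are put in the form slope times \<open>w\<close> plus constant, so
    that each differentiation only contributes a factor equal to the slope.\<close>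
  have eq: "gamma_quotient_logderiv =
    (\<lambda>w. (1/2) * (Digamma ((-1/2) * w + 1/2) - Digamma ((1/2) * w + 1)))"
    by (simp add: fun_eq_iff gamma_quotient_logderiv_def add.commute)
  have hol: "(\<lambda>w. Digamma ((-1/2) * w + 1/2)) holomorphic_on B"
            "(\<lambda>w. Digamma ((1/2) * w + 1)) holomorphic_on B"
    by (rule holomorphic_on_compose_gen[OF _ T(2), unfolded o_def]; use inT in \<open>force intro!: holomorphic_intros\<close>)+
  have "(deriv ^^ n) (\<lambda>w :: complex. Digamma ((-1/2) * w + 1/2)) 0 = (-1/2) ^ n * Polygamma n (1/2)"
    using higher_deriv_compose_linear'[OF T(2) B(1) T(1) B(2) inT(2), of n] inT(2)[OF B(2)]
    by (simp add: higher_deriv_Polygamma T_def)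
  moreover have "(deriv ^^ n) (\<lambda>w :: complex. Digamma ((1/2) * w + 1)) 0 = (1/2) ^ n * Polygamma n 1"
    using higher_deriv_compose_linear'[OF T(2) B(1) T(1) B(2) inT(1), of n] inT(1)[OF B(2)]
    by (simp add: higher_deriv_Polygamma T_def)
  ultimately show ?thesis
    unfolding eq using B hol
    by (subst higher_deriv_cmult[of _ B] higher_deriv_diff[of _ B]; (intro holomorphic_intros)?; simp)+
qed

text \<open>For \<open>n = 0\<close> Euler's constant cancels between the two Digamma values and
  leaves \<open>- ln 2\<close>. For \<open>n > 0\<close> both polygamma values are rational
  multiples of a zeta value.\<close>

lemma higher_deriv_logderiv_in_ring:
  "(deriv ^^ n) gamma_quotient_logderiv 0 \<in> ln2_zeta_ring"
proof (cases "n = 0")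
  case True
  have "Digamma (1/2 :: complex) = - euler_mascheroni - of_real (2 * ln 2)"
    by (rule Digamma_one_half)
  hence "(deriv ^^ n) gamma_quotient_logderiv 0 = - of_real (ln 2)"
    unfolding higher_deriv_gamma_quotient_logderiv by (simp add: True)
  thus ?thesis
    using ln2_in_ring by (simp add: ln2_zeta_ring_def rat_adjoin_uminus)
next
  case False
  have "(deriv ^^ n) gamma_quotient_logderiv 0 =
        ((- 1/2) ^ n * (2 ^ Suc n - 1) - (1/2) ^ n) / 2 * Polygamma n 1"
    unfolding higher_deriv_gamma_quotient_logderiv using False
    by (simp add: Polygamma_one_half algebra_simps)
  moreover have "((- 1/2) ^ n * (2 ^ Suc n - 1) - (1/2) ^ n) / 2 \<in> (\<rat> :: complex set)"
    by (intro Rats_divide Rats_diff Rats_mult Rats_power Rats_minus_iff[THEN iffD2] Rats_1 Rats_number_of)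
  ultimately show ?thesis
    using Polygamma_1_in_ring[of n] False by (simp only: ln2_zeta_ring_def rat_adjoin_rat_mult neq0_conv)
qed

text \<open>The induction is strong because Leibniz' rule expresses the derivative of order
  \<open>k + 1\<close> through all those of order at most \<open>k\<close>.\<close>

lemma higher_deriv_gamma_quotient_in_ring: "(deriv ^^ n) gamma_quotient 0 \<in> ln2_zeta_ring"
proof (induction n rule: less_induct)
  case (less n)
  show ?case
  proof (cases n)
    case 0
    thus ?thesis
      by (simp add: gamma_quotient_0 ln2_zeta_ring_def rat_adjoin.rat)
  next
    case (Suc k)
    define B where "B = ball (0 :: complex) 1"
    have B: "open B" "0 \<in> B" by (auto simp: B_def)
    have hol: "gamma_quotient holomorphic_on B"
      unfolding gamma_quotient_def [abs_def] by (intro holomorphic_intros) auto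
    have hol': "gamma_quotient_logderiv holomorphic_on B"
      unfolding gamma_quotient_logderiv_def [abs_def] B_def
      by (intro holomorphic_intros holomorphic_on_compose_gen[OF _ holomorphic_on_Polygamma[of "- \<int>\<^sub>\<le>\<^sub>0"], unfolded o_def])
         (use nonpos_Ints_outside in auto)
    have "(deriv ^^ n) gamma_quotient 0 = (deriv ^^ k) (deriv gamma_quotient) 0"
      by (simp add: Suc funpow_Suc_right del: funpow.simps)
    \<comment> \<open>The differential equation is available on the disc only; agreement near 0 is
      enough for the derivatives there.\<close>
    also have "\<dots> = (deriv ^^ k) (\<lambda>z. gamma_quotient_logderiv z * gamma_quotient z) 0"
      using B hol hol' deriv_gamma_quotient
      by (intro higher_deriv_transform_within_open[of _ B])
         (auto intro!: holomorphic_intros holomorphic_deriv simp: B_def)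
    also have "\<dots> = (\<Sum>i = 0..k. of_nat (k choose i) *
        (deriv ^^ i) gamma_quotient_logderiv 0 * (deriv ^^ (k - i)) gamma_quotient 0)"
      by (rule higher_deriv_mult[OF hol' hol B])
    also have "\<dots> \<in> ln2_zeta_ring"
      using less.IH Suc higher_deriv_logderiv_in_ring unfolding ln2_zeta_ring_def
      by (intro rat_adjoin_sum rat_adjoin.mult rat_adjoin.rat[of "of_nat _"]) auto
    finally show ?thesis .
  qed
qed

text \<open>By uniqueness of power series, \<open>c n\<close> is the derivative of order
  \<open>n\<close> at 0 divided by \<open>fact n\<close>.\<close>

lemma power_series_coeff_in_ring:
  assumes "\<And>z. (\<lambda>n. c n * z ^ n) sums gamma_quotient z"
  shows "c n \<in> ln2_zeta_ring"
proof -
  have "gamma_quotient has_fps_expansion Abs_fps c"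
    using assms by (intro has_fps_expansionI) simp
  hence "c n = inverse (fact n) * (deriv ^^ n) gamma_quotient 0"
    by (simp add: fps_nth_fps_expansion[of _ "Abs_fps c", simplified] field_simps)
  moreover have "inverse (fact n) \<in> (\<rat> :: complex set)"
    by (metis Rats_inverse Rats_of_nat of_nat_fact)
  ultimately show ?thesis
    using higher_deriv_gamma_quotient_in_ring[of n] unfolding ln2_zeta_ring_def
    by (simp add: rat_adjoin_rat_mult)
qed

section \<open>The generating function as a Gamma quotient\<close>

text \<open>In the product of the Pochhammer symbols of \<open>- z\<close> and \<open>1 + z\<close>,
  the factors \<open>k - z\<close> and \<open>k + z\<close> pair up to
  \<open>k^2 * (1 - z^2 / k^2)\<close> for \<open>1 \<le> k \<le> j\<close>. The first factor
  \<open>- z\<close> and the last factor \<open>z + (j + 1)\<close> stay unpaired.\<close>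

lemma bailey_term_conv_inv_square_prod:
  "bailey_term (- z) 1 (Suc j) =
     (1/2) ^ Suc j * inv_square_prod j (- z\<^sup>2) * (- z * (z + of_nat (Suc j)) / of_nat (Suc j) ^ 2)"
proof (induction j)
  case 0
  show ?case by (simp add: bailey_term_Suc add.commute)
next
  case (Suc j)
  define n where "n = (of_nat (Suc j) :: complex)"
  define C where "C = (1/2) ^ Suc j * inv_square_prod j (- z\<^sup>2)"
  have n: "n \<noteq> 0" "n + 1 \<noteq> 0" "(of_nat (Suc (Suc j)) :: complex) = n + 1"
    using of_nat_neq_0[of j, where 'a = complex] of_nat_neq_0[of "Suc j", where 'a = complex]
    by (simp_all add: n_def add_ac)
  have "bailey_term (- z) 1 (Suc (Suc j)) =
        C * (- z * (z + n) / n\<^sup>2) * ((- z + n) * (1 + z + n) / (2 * (1 + n) * (n + 1)))"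
    by (simp only: bailey_term_Suc[of _ _ "Suc j"] Suc.IH C_def n flip: n_def) simp
  also have "\<dots> = C * ((- z * (z + n) / n\<^sup>2) * ((- z + n) * (1 + z + n) / (2 * (1 + n) * (n + 1))))"
    by (rule mult.assoc)
  also have "(- z * (z + n) / n\<^sup>2) * ((- z + n) * (1 + z + n) / (2 * (1 + n) * (n + 1))) =
             1/2 * (1 + (- z\<^sup>2) / n\<^sup>2) * (- z * (z + (n + 1)) / (n + 1)\<^sup>2)"
  proof -
    have "1 + (- z\<^sup>2) / n\<^sup>2 = (z + n) * (- z + n) / n\<^sup>2"
      using n by (simp add: field_simps power2_eq_square)
    thus ?thesis
      by (simp add: power2_eq_square add_ac mult_ac)
  qed
  also have "C * \<dots> = (1/2) ^ Suc (Suc j) * inv_square_prod (Suc j) (- z\<^sup>2) *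
      (- z * (z + of_nat (Suc (Suc j))) / of_nat (Suc (Suc j)) ^ 2)"
    by (simp only: inv_square_prod_Suc C_def n power_Suc[of _ "Suc j"] mult_ac flip: n_def)
  finally show ?case .
qed

text \<open>At \<open>y = - z^2\<close> the even series without its first term is
  \<open>y * S 2\<close> and the odd one is \<open>- z * S 1\<close>. Their combined summands are
  the terms of the Bailey series after the zeroth.\<close>

lemma G_terms_sums:
  obtains A B where "G_even_term z sums A" "G_odd_term z sums B" "A + B = gamma_quotient z"
proof -
  define y where "y = - z\<^sup>2"
  define f where "f = (\<lambda>(p :: nat) j. (1/2) ^ Suc j / of_nat (Suc j) ^ p * inv_square_prod j y)"
  define S where "S = (\<lambda>p. \<Sum>j. f p j)"
  have f: "f p sums S p" and Li: "(\<lambda>m. Li (p # replicate m 2) (1/2) * y ^ m) sums S p" for p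
    using Li_replicate_2_generating_function[of "1/2" p y]
    by (simp_all add: f_def S_def summable_sums)
  have y_power: "(-1) ^ m * z ^ (2 * m) = y ^ m" for m
    by (simp add: y_def power_mult flip: power_mult_distrib)
  have "(\<lambda>m. G_even_term z (Suc m)) sums (y * S 2)"
  proof -
    have "G_even_term z k = Li (replicate k 2) (1/2) * y ^ k" for k
      unfolding G_even_term_def by (simp add: mult_ac flip: y_power)
    hence "G_even_term z (Suc m) = y * (Li (2 # replicate m 2) (1/2) * y ^ m)" for m
      by simp
    thus ?thesis using sums_mult[OF Li[of 2], of y] by simp
  qed
  \<comment> \<open>The added 1 is the empty-index value of \<open>Li\<close>; it will match the
    zeroth term of the Bailey series.\<close>
  hence even: "G_even_term z sums (y * S 2 + 1)"
    using sums_Suc[of "G_even_term z"] by (simp add: G_even_term_def[of z 0] Li_def[of "[]"])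
  have odd: "G_odd_term z sums (- z * S 1)"
  proof -
    have "G_odd_term z = (\<lambda>m. - z * (Li (1 # replicate m 2) (1/2) * y ^ m))"
      by (simp add: fun_eq_iff G_odd_term_def mult_ac flip: y_power)
    thus ?thesis by (simp only: sums_mult[OF Li[of 1], of "- z"])
  qed
  have "bailey_term (- z) 1 (Suc j) = y * f 2 j + (- z) * f 1 j" for j
  proof -
    define n where "n = (of_nat (Suc j) :: complex)"
    have "n \<noteq> 0" using of_nat_neq_0[of j, where 'a = complex] by (simp add: n_def)
    hence eq: "- z * (z + n) / n ^ 2 = y / n ^ 2 - z / n ^ 1"
      by (simp add: y_def field_simps power2_eq_square)
    have "w * P * (y / n ^ 2 - z / n ^ 1) = y * (w / n ^ 2 * P) + (- z) * (w / n ^ 1 * P)"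
      for w P :: complex
      by (simp add: right_diff_distrib mult_ac)
    thus ?thesis
      unfolding bailey_term_conv_inv_square_prod f_def y_def[symmetric] n_def[symmetric] eq .
  qed
  hence "(\<lambda>j. bailey_term (- z) 1 (Suc j)) sums (y * S 2 + (- z) * S 1)"
    using sums_add[OF sums_mult[OF f[of 2], of y] sums_mult[OF f[of 1], of "- z"]] by simp
  from sums_Suc[OF this] have "bailey_sum (- z) 1 = y * S 2 + 1 + (- z * S 1)"
    unfolding bailey_sum_def by (simp add: sums_iff)
  moreover have "bailey_sum (- z) 1 = gamma_quotient z"
    by (simp add: bailey_sum_1 gamma_quotient_def)
  ultimately show ?thesis
    using that[OF even odd] by simp
qed

text \<open>Apply \<open>sums_if\<close> to real and imaginary parts separately.\<close>

lemma sums_if_complex: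
  fixes f g :: "nat \<Rightarrow> complex"
  assumes "g sums x" "f sums y"
  shows "(\<lambda>n. if even n then f (n div 2) else g ((n - 1) div 2)) sums (x + y)"
proof -
  have if_Re: "Re (if b then u else v) = (if b then Re u else Re v)"
   and if_Im: "Im (if b then u else v) = (if b then Im u else Im v)" for b u v by auto
  show ?thesis
    using assms sums_if[of "\<lambda>n. Re (g n)" "Re x" "\<lambda>n. Re (f n)" "Re y"]
      sums_if[of "\<lambda>n. Im (g n)" "Im x" "\<lambda>n. Im (f n)" "Im y"]
    by (simp add: sums_complex_iff if_Re if_Im)
qed

lemma Li_replicate_2_one_half_in_ring:
  "Li (replicate m 2) (1/2) \<in> ln2_zeta_ring" "Li (1 # replicate m 2) (1/2) \<in> ln2_zeta_ring"
proof -
  \<comment> \<open>Interleaving the two series gives one power series for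
    \<open>gamma_quotient\<close>, with these coefficients.\<close>
  define c where "c = (\<lambda>n. if even n then (-1) ^ (n div 2) * Li (replicate (n div 2) 2) (1/2)
    else (-1) ^ ((n - 1) div 2 + 1) * Li (1 # replicate ((n - 1) div 2) 2) (1/2))"
  have "(\<lambda>n. c n * z ^ n) sums gamma_quotient z" for z
  proof -
    obtain A B where AB: "G_even_term z sums A" "G_odd_term z sums B" "A + B = gamma_quotient z"
      by (rule G_terms_sums)
    have "(\<lambda>n. c n * z ^ n) =
          (\<lambda>n. if even n then G_even_term z (n div 2) else G_odd_term z ((n - 1) div 2))"
      by (auto simp: fun_eq_iff c_def G_even_term_def G_odd_term_def elim!: evenE oddE)
    thus ?thesis
      using sums_if_complex[OF AB(2,1)] AB(3) by (simp add: add.commute)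
  qed
  from power_series_coeff_in_ring[OF this]
  have "c (2 * m) \<in> ln2_zeta_ring" "c (2 * m + 1) \<in> ln2_zeta_ring"
    by blast+
  \<comment> \<open>A second multiplication by the same sign removes it from the
    coefficient.\<close>
  hence "(-1) ^ m * c (2 * m) \<in> ln2_zeta_ring" "(-1) ^ (m + 1) * c (2 * m + 1) \<in> ln2_zeta_ring"
    unfolding ln2_zeta_ring_def by (intro rat_adjoin_rat_mult; simp)+
  moreover have "(-1) ^ k * ((-1) ^ k * x) = (x :: complex)" for k x
    by (simp flip: mult.assoc power_mult_distrib)
  ultimately show "Li (replicate m 2) (1/2) \<in> ln2_zeta_ring" "Li (1 # replicate m 2) (1/2) \<in> ln2_zeta_ring"
    by (simp_all only: c_def even_mult_iff even_numeral even_add odd_one simp_thms if_True if_False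
          nonzero_mult_div_cancel_left zero_neq_numeral add_diff_cancel_right' not_False_eq_True)
qed

theorem theorem10:
  shows "(\<forall>m. Li (replicate m 2) (1/2) \<in> ln2_zeta_ring \<and>
              Li (1 # replicate m 2) (1/2) \<in> ln2_zeta_ring) \<and>
         (\<forall>z. summable (G_even_term z) \<and> summable (G_odd_term z) \<and>
              G z = Gamma (1/2) / (Gamma (1 + z/2) * Gamma (1/2 - z/2)))"
proof (intro conjI allI)
  fix z
  obtain A B where AB: "G_even_term z sums A" "G_odd_term z sums B" "A + B = gamma_quotient z"
    by (rule G_terms_sums)
  thus "summable (G_even_term z)" "summable (G_odd_term z)"
    by (auto simp: sums_iff)
  show "G z = Gamma (1/2) / (Gamma (1 + z/2) * Gamma (1/2 - z/2))"
    \<comment> \<open>Passing to \<open>rGamma\<close> covers the poles of the Gamma factors as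
      well, so no \<open>z\<close> is exceptional.\<close>
    using AB unfolding divide_Gamma_mult_eq_rGamma by (simp add: G_def gamma_quotient_def sums_iff)
qed (rule Li_replicate_2_one_half_in_ring)+

end
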